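(* Let $a_0\in\mathbb{R}$ with $|a_0|<1$, let $\sigma^2>0$, and let $\{e_t\}_{t\in\mathbb{Z}}$ be Gaussian white noise of variance $\sigma^2$. Let $\{y_t\}_{t\in\mathbb{Z}}$ be the stationary AR(1) process satisfying $y_t=a_0y_{t-1}+e_t$ for all $t$, and for $N\ge 2$ let $$\hat a_N:=\frac{\sum_{t=2}^N y_ty_{t-1}}{\sum_{t=1}^{N-1}y_t^2}$$ be the least squares estimate of $a_0$ from $y_1,\dots,y_N$. Then for all $\varepsilon>0$ and all integers $N\ge 2$, $$\mathbb{P}(\hat a_N-a_0>\varepsilon)\le\left(\frac{1-a_0^2}{1-a_0^2+\varepsilon^2}\right)^{\frac14}\left(\frac{1+a_0^2+\varepsilon^2}{2}+\sqrt{\left(\frac{1+a_0^2+\varepsilon^2}{2}\right)^2-a_0^2}\right)^{-\frac{N-2}{4}}.$$ Furthermore, for all integers $N\ge 7$, $$\operatorname{var}\{\hat a_N\}\le\frac{8}{N-6}-\frac{8a_0^2}{N+2},$$ where $\operatorname{var}\{\hat a_N\}:=\mathbb{E}[(\hat a_N-a_0)^2]$.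
   Context: Gaussian white noise of variance $\sigma^2$ means that the $e_t$ are independent and identically distributed $\mathcal{N}(0,\sigma^2)$ random variables. For $|a_0|<1$ the stationary solution of $y_t=a_0y_{t-1}+e_t$ is $y_t=\sum_{k\ge0}a_0^k e_{t-k}$; thus $y_1\sim\mathcal{N}(0,\sigma^2/(1-a_0^2))$ and $e_t$ is independent of $\{y_s\}_{s<t}$. The notation $\operatorname{var}\{\hat a_N\}$ denotes the mean squared deviation from the true parameter, $\mathbb{E}[(\hat a_N-a_0)^2]$ (not the variance centered at the mean of $\hat a_N$). The denominator of $\hat a_N$ is nonzero almost surely. *)

theory Defs
  imports "HOL-Probability.Probability"
begin

definition gaussian_white_noise :: "'a measure \<Rightarrow> real \<Rightarrow> (int \<Rightarrow> 'a \<Rightarrow> real) \<Rightarrow> bool" where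
  "gaussian_white_noise M \<sigma> e \<longleftrightarrow>
     prob_space.indep_vars M (\<lambda>_. borel) e UNIV \<and>
     (\<forall>t. distributed M lborel (e t) (normal_density 0 \<sigma>))"

text \<open>Strict stationarity: the law of the whole path on the product sigma-algebra is invariant
  under every time shift.\<close>

definition stationary_process :: "'a measure \<Rightarrow> (int \<Rightarrow> 'a \<Rightarrow> real) \<Rightarrow> bool" where
  "stationary_process M y \<longleftrightarrow>
     (\<forall>t. y t \<in> borel_measurable M) \<and>
     (\<forall>h. distr M (Pi\<^sub>M UNIV (\<lambda>_. borel)) (\<lambda>\<omega> t. y (t + h) \<omega>) =
          distr M (Pi\<^sub>M UNIV (\<lambda>_. borel)) (\<lambda>\<omega> t. y t \<omega>))"

text \<open>For \<open>\<bar>a\<bar> < 1\<close> and white noise \<open>e\<close>, these two conditions determine \<open>y\<close> up to almost sure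
  equality: it is \<open>y t = (\<Sum>k. a ^ k * e (t - k))\<close>. That series converges only almost surely,
  so the recursion is also required only almost surely.\<close>

definition stationary_AR1 ::
  "'a measure \<Rightarrow> real \<Rightarrow> (int \<Rightarrow> 'a \<Rightarrow> real) \<Rightarrow> (int \<Rightarrow> 'a \<Rightarrow> real) \<Rightarrow> bool" where
  "stationary_AR1 M a e y \<longleftrightarrow>
     stationary_process M y \<and>
     (\<forall>t. AE \<omega> in M. y t \<omega> = a * y (t - 1) \<omega> + e t \<omega>)"

definition ls_estimate :: "(int \<Rightarrow> 'a \<Rightarrow> real) \<Rightarrow> nat \<Rightarrow> 'a \<Rightarrow> real" where
  "ls_estimate y N \<omega> =
     (\<Sum>t = 2..int N. y t \<omega> * y (t - 1) \<omega>) / (\<Sum>t = 1..int N - 1. (y t \<omega>)\<^sup>2)"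

end

theory Submission imports Defs begin

text \<open>
  Write \<open>W = \<Sum>t. e (t + 1) * y t\<close> and \<open>D = \<Sum>t. (y t)\<^sup>2\<close>, so that the estimation error is \<open>W / D\<close> and
  exceeds \<open>\<epsilon>\<close> iff \<open>W - \<epsilon> * D > 0\<close>. With \<open>\<theta> = \<epsilon> / \<sigma>\<^sup>2\<close>, the exponential moment of
  \<open>\<theta> / 2 * (W - \<epsilon> * D)\<close> is at most the square root of the product of the expectation of
  \<open>exp (\<theta> * W - \<theta>\<^sup>2 * \<sigma>\<^sup>2 / 2 * D)\<close>, which is \<open>1\<close> (an exponential martingale), and of
  \<open>exp (- \<epsilon>\<^sup>2 / (2 * \<sigma>\<^sup>2) * D)\<close>, a Gaussian integral that integrating out one noise variable at a time
  bounds by a power of the larger root \<open>\<rho>\<close> of \<open>\<rho> + a\<^sup>2 / \<rho> = 1 + a\<^sup>2 + \<epsilon>\<^sup>2\<close>. The error has the same bound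
  on both tails; taking \<open>\<rho>\<close> instead of \<open>\<epsilon>\<close> as the variable of the tail integral gives the second
  moment in closed form.
\<close>

section \<open>Gaussian integrals and characteristic functions\<close>

text \<open>Completing the square: with \<open>q = 1 + 2 * c * s\<^sup>2\<close>, the integrand is a
  constant times the normal density of mean \<open>b * s\<^sup>2 / q\<close> and standard deviation
  \<open>s / sqrt q\<close>.\<close>

lemma nn_integral_exp_quadratic_normal:
  fixes b c s :: real
  assumes s: "0 < s" and pos: "0 < 1 + 2 * c * s\<^sup>2"
  shows "(\<integral>\<^sup>+x. ennreal (exp (b * x - c * x\<^sup>2)) * ennreal (normal_density 0 s x) \<partial>lborel) =
    ennreal (exp (b\<^sup>2 * s\<^sup>2 / (2 * (1 + 2 * c * s\<^sup>2))) / sqrt (1 + 2 * c * s\<^sup>2))"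
proof -
  define q where "q = 1 + 2 * c * s\<^sup>2"
  define t where "t = s / sqrt q"
  have q: "q > 0" using pos by (simp add: q_def)
  have t: "t > 0" using s q by (simp add: t_def)
  have t2: "t\<^sup>2 = s\<^sup>2 / q" using q by (simp add: t_def power_divide)
  have c: "c = (q - 1) / (2 * s\<^sup>2)" using s by (simp add: q_def)
  define K where "K = exp (b\<^sup>2 * s\<^sup>2 / (2 * q)) / sqrt q"
  have K: "K \<ge> 0" using q by (simp add: K_def)
  have ex: "b * x - c * x\<^sup>2 - x\<^sup>2 / (2 * s\<^sup>2) = b\<^sup>2 * s\<^sup>2 / (2 * q) - (x - b * t\<^sup>2)\<^sup>2 / (2 * t\<^sup>2)" for x
    unfolding t2 c using s q by (simp add: field_simps power2_eq_square)
  have "exp (b * x - c * x\<^sup>2) * normal_density 0 s x = K * normal_density (b * t\<^sup>2) t x" for x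
  proof -
    have "exp (b * x - c * x\<^sup>2) * normal_density 0 s x =
        exp (b * x - c * x\<^sup>2 - x\<^sup>2 / (2 * s\<^sup>2)) / sqrt (2 * pi * s\<^sup>2)"
      by (simp add: normal_density_def flip: exp_add)
    also have "sqrt (2 * pi * s\<^sup>2) = sqrt q * sqrt (2 * pi * t\<^sup>2)"
      using q by (simp add: t2 real_sqrt_mult real_sqrt_divide)
    finally show ?thesis
      unfolding ex by (simp add: K_def normal_density_def mult_exp_exp)
  qed
  then have "(\<integral>\<^sup>+x. ennreal (exp (b * x - c * x\<^sup>2)) * ennreal (normal_density 0 s x) \<partial>lborel) =
      (\<integral>\<^sup>+x. ennreal K * ennreal (normal_density (b * t\<^sup>2) t x) \<partial>lborel)"
    using K by (simp flip: ennreal_mult')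
  also have "\<dots> = ennreal K * (\<integral>\<^sup>+x. ennreal (normal_density (b * t\<^sup>2) t x) \<partial>lborel)"
    by (rule nn_integral_cmult) simp
  also have "(\<integral>\<^sup>+x. ennreal (normal_density (b * t\<^sup>2) t x) \<partial>lborel) = 1"
    using t by (subst nn_integral_eq_integral) auto
  finally show ?thesis by (simp add: K_def q_def)
qed

lemma char_normal:
  assumes s: "0 < s"
  shows "char (density lborel (normal_density 0 s)) = (\<lambda>t. complex_of_real (exp (- (s * t)\<^sup>2 / 2)))"
proof
  fix t
  interpret N: prob_space "density lborel (\<lambda>x. ennreal (normal_density 0 s x))"
    using prob_space_normal_density[OF s] .
  have *: "density lborel std_normal_density =
      distr (density lborel (normal_density 0 s)) borel (\<lambda>x. x / s)"
  proof -
    have "distributed (density lborel (normal_density 0 s)) lborel (\<lambda>x. x) (normal_density 0 s)"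
      by (auto simp: distributed_def intro!: measure_eqI simp: emeasure_distr)
    then have "distributed (density lborel (normal_density 0 s)) lborel (\<lambda>x. (x - 0) / s)
        std_normal_density"
      by (subst (asm) N.normal_standard_normal_convert[OF s])
    then show ?thesis
      by (simp add: distributed_def cong: distr_cong)
  qed
  have "char std_normal_distribution (s * t) =
      (CLINT x|density lborel (normal_density 0 s). iexp (s * t * (x / s)))"
    unfolding char_def * by (subst integral_distr) auto
  also have "\<dots> = char (density lborel (normal_density 0 s)) t"
    using s by (simp add: char_def)
  finally show "char (density lborel (normal_density 0 s)) t = complex_of_real (exp (- (s * t)\<^sup>2 / 2))"
    by (simp add: char_std_normal_distribution)
qed

section \<open>The larger root of a quadratic, and integration of tail bounds\<close>

text \<open>\<open>h + sqrt (h\<^sup>2 - q)\<close> is the larger root of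
  \<open>r\<^sup>2 - 2 * h * r + q = 0\<close>; dividing by the root gives the second claim. This
  identifies the base of the power in the deviation bound with \<open>\<rho>\<close>, and supplies
  preimages under the map from \<open>r\<close> to \<open>r + q / r\<close> on
  \<open>r \<ge> 1\<close>.\<close>

lemma plus_divide_root:
  fixes q x :: real
  assumes q: "0 \<le> q" "q < 1" and x: "0 \<le> x"
  defines "h \<equiv> (1 + q + x) / 2"
  shows "1 \<le> h + sqrt (h\<^sup>2 - q)" "(h + sqrt (h\<^sup>2 - q)) + q / (h + sqrt (h\<^sup>2 - q)) = 1 + q + x"
proof -
  have "((1 + q) / 2)\<^sup>2 \<le> h\<^sup>2" unfolding h_def using q x by (intro power_mono) auto
  moreover have "((1 + q) / 2)\<^sup>2 = ((1 - q) / 2)\<^sup>2 + q" by (simp add: power2_eq_square field_simps)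
  ultimately have disc: "((1 - q) / 2)\<^sup>2 \<le> h\<^sup>2 - q" by simp
  then have "(1 - q) / 2 \<le> sqrt (h\<^sup>2 - q)" by (rule real_le_rsqrt)
  then show *: "1 \<le> h + sqrt (h\<^sup>2 - q)" using x by (simp add: h_def field_simps)
  have "0 \<le> h\<^sup>2 - q" using disc zero_le_power2 order_trans by blast
  then have "(sqrt (h\<^sup>2 - q))\<^sup>2 = h\<^sup>2 - q" by simp
  then have "(h + sqrt (h\<^sup>2 - q)) * (h + sqrt (h\<^sup>2 - q)) + q = 2 * h * (h + sqrt (h\<^sup>2 - q))"
    by (simp add: power2_eq_square algebra_simps)
  moreover have "r + q / r = 2 * h" if "r * r + q = 2 * h * r" "1 \<le> r" for r
    using that by (simp add: add_divide_eq_iff)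
  ultimately have "(h + sqrt (h\<^sup>2 - q)) + q / (h + sqrt (h\<^sup>2 - q)) = 2 * h"
    using * by blast
  also have "2 * h = 1 + q + x" by (simp add: h_def)
  finally show "(h + sqrt (h\<^sup>2 - q)) + q / (h + sqrt (h\<^sup>2 - q)) = 1 + q + x" .
qed

text \<open>The layers of \<open>V\<close> are indexed by \<open>r \<ge> 1\<close> through the level \<open>r + q / r - 1 - q\<close>, in terms of
  which the deviation bound is a pure power of \<open>r\<close>.\<close>

lemma (in prob_space) nn_integral_le_of_tail_bound:
  fixes V :: "'a \<Rightarrow> real" and q k :: real
  assumes V [measurable]: "V \<in> borel_measurable M" and V_nonneg: "\<And>\<omega>. 0 \<le> V \<omega>"
    and q: "0 \<le> q" "q < 1" and k: "1 < k"
    and tail: "\<And>r. 1 < r \<Longrightarrow> prob {\<omega> \<in> space M. r + q / r - 1 - q \<le> V \<omega>} \<le> 2 * r powr - k"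
  shows "(\<integral>\<^sup>+\<omega>. ennreal (V \<omega>) \<partial>M) \<le> ennreal (2 / (k - 1) - 2 * q / (k + 1))"
proof -
  interpret L: pair_sigma_finite lborel M ..
  \<comment> \<open>\<open>?w\<close> is the derivative of \<open>r + q / r\<close>, cut off to
    \<open>r \<ge> 1\<close>, where it is nonnegative.\<close>
  let ?w = "\<lambda>r. ennreal (1 - q / r\<^sup>2) * indicator {1 ..} r"
  let ?I = "\<lambda>r \<omega>. indicator {z. fst z + q / fst z - 1 - q \<le> V (snd z)} (r, \<omega>) :: ennreal"
  have w_nonneg: "0 \<le> 1 - q / r\<^sup>2" if "1 \<le> r" for r
  proof -
    have "1 \<le> r\<^sup>2" using that by (simp add: one_le_power)
    then show ?thesis using q by (simp add: divide_le_eq)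
  qed
  have deriv: "DERIV (\<lambda>r. r + q / r) r :> 1 - q / r\<^sup>2" if "1 \<le> r" for r
    using that by (auto intro!: derivative_eq_intros simp: power2_eq_square)
  \<comment> \<open>Layer-cake formula after a substitution: \<open>v\<close> is the integral of the
    derivative from 1 to the \<open>R\<close> with \<open>R + q / R = 1 + q + v\<close>, and by
    monotonicity every \<open>r\<close> in that interval has level at most \<open>v\<close>.\<close>
  have layer: "ennreal v \<le> (\<integral>\<^sup>+r. ?w r * of_bool (r + q / r - 1 - q \<le> v) \<partial>lborel)"
    if v: "0 \<le> v" for v
  proof -
    define S where "S = 1 + q + v"
    obtain R where R: "1 \<le> R" and RS: "R + q / R = S"
      using plus_divide_root[OF q v] unfolding S_def by blast
    have mono: "r + q / r \<le> S" if "1 \<le> r" "r \<le> R" for r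
      unfolding RS[symmetric] using that(2)
    proof (rule DERIV_nonneg_imp_nondecreasing)
      fix x assume "r \<le> x"
      then have "1 \<le> x" using that by simp
      then show "\<exists>d. DERIV (\<lambda>r. r + q / r) x :> d \<and> 0 \<le> d"
        using deriv w_nonneg by blast
    qed
    have "ennreal v = ennreal ((R + q / R) - (1 + q / 1))"
      using RS by (simp add: S_def)
    also have "\<dots> = (\<integral>\<^sup>+r. ennreal (1 - q / r\<^sup>2) * indicator {1 .. R} r \<partial>lborel)"
      using R deriv w_nonneg by (intro nn_integral_FTC_Icc[symmetric]) auto
    also have "\<dots> \<le> (\<integral>\<^sup>+r. ?w r * of_bool (r + q / r - 1 - q \<le> v) \<partial>lborel)"
      using mono by (intro nn_integral_mono) (auto simp: indicator_def S_def algebra_simps)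
    finally show ?thesis .
  qed
  have "(\<integral>\<^sup>+\<omega>. ennreal (V \<omega>) \<partial>M) \<le> (\<integral>\<^sup>+\<omega>. (\<integral>\<^sup>+r. ?w r * ?I r \<omega> \<partial>lborel) \<partial>M)"
    using layer[OF V_nonneg] by (intro nn_integral_mono) (simp add: indicator_def)
  also have "\<dots> = (\<integral>\<^sup>+r. (\<integral>\<^sup>+\<omega>. ?w r * ?I r \<omega> \<partial>M) \<partial>lborel)"
    by (rule L.Fubini') measurable
  also have "\<dots> \<le> (\<integral>\<^sup>+r. ennreal ((1 - q / r\<^sup>2) * (2 * r powr - k)) * indicator {1 ..} r \<partial>lborel)"
  proof (rule nn_integral_mono)
    fix r :: real
    have "(\<integral>\<^sup>+\<omega>. ?w r * ?I r \<omega> \<partial>M) =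
        ?w r * (\<integral>\<^sup>+\<omega>. indicator {\<omega> \<in> space M. r + q / r - 1 - q \<le> V \<omega>} \<omega> \<partial>M)"
      by (subst nn_integral_cmult[symmetric])
        (auto intro!: nn_integral_cong simp: indicator_def)
    also have "\<dots> = ?w r * ennreal (prob {\<omega> \<in> space M. r + q / r - 1 - q \<le> V \<omega>})"
      by (subst nn_integral_indicator) (auto simp: emeasure_eq_measure)
    also have "\<dots> \<le> ?w r * ennreal (2 * r powr - k)"
    proof (cases "1 \<le> r")
      case True
      have "prob {\<omega> \<in> space M. r + q / r - 1 - q \<le> V \<omega>} \<le> 2 * r powr - k"
      \<comment> \<open>The tail hypothesis starts beyond 1; at \<open>r = 1\<close> the bound is 2
        and holds trivially.\<close>
      proof (cases "r = 1")
        case True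
        then show ?thesis by (simp add: order_trans[OF prob_le_1])
      qed (use tail \<open>1 \<le> r\<close> in auto)
      then show ?thesis by (intro mult_left_mono ennreal_leI) auto
    qed auto
    also have "\<dots> = ennreal ((1 - q / r\<^sup>2) * (2 * r powr - k)) * indicator {1 ..} r"
      using w_nonneg[of r] by (auto simp: indicator_def ennreal_mult')
    finally show "(\<integral>\<^sup>+\<omega>. ?w r * ?I r \<omega> \<partial>M) \<le>
        ennreal ((1 - q / r\<^sup>2) * (2 * r powr - k)) * indicator {1 ..} r" .
  qed
  \<comment> \<open>The integrand is \<open>2 * r powr - k - 2 * q * r powr (- 2 - k)\<close>; its
    antiderivative vanishes at infinity because \<open>k > 1\<close>, so only the value at 1
    remains.\<close>
  also have "\<dots> = ennreal (0 - (2 * (1 powr (1 - k) / (1 - k)) + 2 * q * (1 powr (- 1 - k) / (k + 1))))"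
  proof (rule nn_integral_FTC_atLeast[where
        F = "\<lambda>r. 2 * (r powr (1 - k) / (1 - k)) + 2 * q * (r powr (- 1 - k) / (k + 1))"])
    fix r :: real assume r: "1 \<le> r"
    have "r powr (- 2 - k) = r powr - k / r\<^sup>2"
      using r by (simp add: powr_diff powr_minus field_simps)
    then have eq: "(1 - q / r\<^sup>2) * (2 * r powr - k) = 2 * r powr - k - 2 * q * r powr (- 2 - k)"
      by (simp add: algebra_simps)
    have "DERIV (\<lambda>r. 2 * (r powr (1 - k) / (1 - k)) + 2 * q * (r powr (- 1 - k) / (k + 1))) r :>
        2 * r powr - k - 2 * q * r powr (- 2 - k)"
    proof -
      have powr: "DERIV (\<lambda>r. r powr c) r :> c * r powr (c - 1)" for c :: real
        using r by (intro has_real_derivative_powr) auto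
      have "DERIV (\<lambda>r. r powr (1 - k) / (1 - k)) r :> r powr - k"
        using DERIV_cdivide[OF powr[of "1 - k"], of "1 - k"] k by simp
      moreover have "(- 1 - k) * x / (k + 1) = - x" for x
        using k by (simp add: divide_eq_eq algebra_simps)
      then have "DERIV (\<lambda>r. r powr (- 1 - k) / (k + 1)) r :> - (r powr (- 1 - k - 1))"
        using DERIV_cdivide[OF powr[of "- 1 - k"], of "k + 1"] by simp
      moreover have "- 1 - k - 1 = - 2 - k" by simp
      ultimately show ?thesis
        using DERIV_add[OF DERIV_cmult[of _ _ r UNIV 2] DERIV_cmult[of _ _ r UNIV "2 * q"]] by fastforce
    qed
    then show "DERIV (\<lambda>r. 2 * (r powr (1 - k) / (1 - k)) + 2 * q * (r powr (- 1 - k) / (k + 1))) r :>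
        (1 - q / r\<^sup>2) * (2 * r powr - k)"
      unfolding eq .
    show "0 \<le> (1 - q / r\<^sup>2) * (2 * r powr - k)" using w_nonneg[OF r] by simp
  next
    have "((\<lambda>r::real. r powr (1 - k)) \<longlongrightarrow> 0) at_top" "((\<lambda>r::real. r powr (- 1 - k)) \<longlongrightarrow> 0) at_top"
      using k by (auto intro!: tendsto_neg_powr filterlim_ident)
    then have "((\<lambda>r. 2 * (r powr (1 - k) / (1 - k)) + 2 * q * (r powr (- 1 - k) / (k + 1)))
        \<longlongrightarrow> 2 * (0 / (1 - k)) + 2 * q * (0 / (k + 1))) at_top"
      using k by (intro tendsto_intros) auto
    then show "((\<lambda>r. 2 * (r powr (1 - k) / (1 - k)) + 2 * q * (r powr (- 1 - k) / (k + 1))) \<longlongrightarrow> 0) at_top"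
      by simp
  qed simp
  also have "0 - (2 * (1 powr (1 - k) / (1 - k)) + 2 * q * (1 powr (- 1 - k) / (k + 1))) =
      2 / (k - 1) - 2 * q / (k + 1)"
  proof -
    have "1 / (1 - k) = - (1 / (k - 1))" by (metis minus_diff_eq minus_divide_right)
    then show ?thesis by simp
  qed
  finally show ?thesis .
qed

section \<open>Stationarity and the representation of the process by past noise\<close>

locale gaussian_ar1 = prob_space M for M :: "'a measure" +
  fixes a \<sigma> :: real and e y :: "int \<Rightarrow> 'a \<Rightarrow> real"
  assumes abs_a_less: "\<bar>a\<bar> < 1"
    and \<sigma>_pos: "\<sigma> > 0"
    and noise: "gaussian_white_noise M \<sigma> e"
    and ar1: "stationary_AR1 M a e y"
begin

lemma indep_e: "indep_vars (\<lambda>_. borel) e UNIV"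
  and distributed_e: "distributed M lborel (e t) (normal_density 0 \<sigma>)"
  using noise by (auto simp: gaussian_white_noise_def)

lemma measurable_e [measurable]: "e t \<in> borel_measurable M"
  using distributed_measurable[OF distributed_e[of t]] by simp

lemma distr_e: "distr M borel (e t) = density lborel (normal_density 0 \<sigma>)"
  using distributed_distr_eq_density[OF distributed_e[of t]] by (simp cong: distr_cong)

lemma measurable_y [measurable]: "y t \<in> borel_measurable M"
  using ar1 by (auto simp: stationary_AR1_def stationary_process_def)

lemma recursion: "AE \<omega> in M. y t \<omega> = a * y (t - 1) \<omega> + e t \<omega>"
  using ar1 by (auto simp: stationary_AR1_def)

lemma distr_y_eq: "distr M borel (y t) = distr M borel (y s)"
proof -
  have "distr M borel (y h) = distr M borel (y 0)" for h
  proof -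
    have "distr M (Pi\<^sub>M UNIV (\<lambda>_. borel)) (\<lambda>\<omega> t. y (t + h) \<omega>) =
        distr M (Pi\<^sub>M UNIV (\<lambda>_. borel)) (\<lambda>\<omega> t. y t \<omega>)"
      using ar1 by (auto simp: stationary_AR1_def stationary_process_def)
    then have "distr (distr M (Pi\<^sub>M UNIV (\<lambda>_. borel)) (\<lambda>\<omega> t. y (t + h) \<omega>)) borel (\<lambda>x. x 0) =
        distr (distr M (Pi\<^sub>M UNIV (\<lambda>_. borel)) (\<lambda>\<omega> t. y t \<omega>)) borel (\<lambda>x. x 0)"
      by simp
    moreover have "(\<lambda>\<omega> t. y (t + h) \<omega>) \<in> M \<rightarrow>\<^sub>M Pi\<^sub>M UNIV (\<lambda>_. borel)" for h
      by (rule measurable_PiM_single') auto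
    note this[of h] this[of 0]
    ultimately show ?thesis
      by (simp add: distr_distr comp_def)
  qed
  then show ?thesis by metis
qed

lemma recursion_iterate:
  "AE \<omega> in M. y t \<omega> = a ^ n * y (t - int n) \<omega> + (\<Sum>k<n. a ^ k * e (t - int k) \<omega>)"
proof (induction n)
  case (Suc n)
  from Suc recursion[of "t - int n"] show ?case
    by eventually_elim (simp add: algebra_simps)
qed simp

text \<open>No moment of \<open>y\<close> is known at this point, hence the truncation at 1. By
  stationarity the remainder has the law of \<open>a ^ n * y t\<close>, which tends to 0 pointwise,
  and dominated convergence applies.\<close>

lemma expectation_min_tendsto_0:
  "(\<lambda>n. \<integral>\<omega>. min 1 \<bar>a ^ n * y (t - int n) \<omega>\<bar> \<partial>M) \<longlonglongrightarrow> 0"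
proof -
  have "(\<integral>\<omega>. min 1 \<bar>a ^ n * y (t - int n) \<omega>\<bar> \<partial>M) = (\<integral>\<omega>. min 1 \<bar>a ^ n * y t \<omega>\<bar> \<partial>M)" for n
    using integral_distr[of "y (t - int n)" M borel "\<lambda>x. min 1 \<bar>a ^ n * x\<bar>"]
      integral_distr[of "y t" M borel "\<lambda>x. min 1 \<bar>a ^ n * x\<bar>"] distr_y_eq[of "t - int n" t]
    by simp
  moreover have "(\<lambda>n. \<integral>\<omega>. min 1 \<bar>a ^ n * y t \<omega>\<bar> \<partial>M) \<longlonglongrightarrow> (\<integral>\<omega>. 0 \<partial>M)"
  proof (rule integral_dominated_convergence[where w = "\<lambda>_. 1"])
    have "(\<lambda>n. min 1 \<bar>a ^ n * y t \<omega>\<bar>) \<longlonglongrightarrow> min 1 \<bar>0 * y t \<omega>\<bar>" for \<omega>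
      using abs_a_less by (intro tendsto_intros LIMSEQ_power_zero) auto
    then show "AE \<omega> in M. (\<lambda>n. min 1 \<bar>a ^ n * y t \<omega>\<bar>) \<longlonglongrightarrow> 0" by simp
  qed auto
  ultimately show ?thesis by simp
qed

text \<open>The remainder of the iterated recursion tends to 0 in probability, hence almost surely
  along a subsequence, which suffices to express \<open>y t\<close> through past noise.\<close>

lemma y_AE_limit:
  "\<exists>r. AE \<omega> in M. (\<lambda>n. \<Sum>k<r n. a ^ k * e (t - int k) \<omega>) \<longlonglongrightarrow> y t \<omega>"
proof -
  have "\<exists>r. strict_mono r \<and>
      (AE \<omega> in M. (\<lambda>n. min 1 \<bar>a ^ r n * y (t - int (r n)) \<omega>\<bar>) \<longlonglongrightarrow> 0)"
    using expectation_min_tendsto_0[of t]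
    by (intro tendsto_L1_AE_subseq[where u = "\<lambda>n \<omega>. min 1 \<bar>a ^ n * y (t - int n) \<omega>\<bar>"]
          integrable_const_bound[where B = 1]) auto
  then obtain r where
    "AE \<omega> in M. (\<lambda>n. min 1 \<bar>a ^ r n * y (t - int (r n)) \<omega>\<bar>) \<longlonglongrightarrow> 0" by blast
  moreover have "AE \<omega> in M. \<forall>n. y t \<omega> =
      a ^ n * y (t - int n) \<omega> + (\<Sum>k<n. a ^ k * e (t - int k) \<omega>)"
    by (simp add: AE_all_countable recursion_iterate)
  ultimately have "AE \<omega> in M. (\<lambda>n. \<Sum>k<r n. a ^ k * e (t - int k) \<omega>) \<longlonglongrightarrow> y t \<omega>"
  proof eventually_elim
    case (elim \<omega>)
    have "eventually (\<lambda>n. min 1 \<bar>a ^ r n * y (t - int (r n)) \<omega>\<bar> < 1) sequentially"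
      using elim(1) by (rule order_tendstoD) simp
    then have "eventually (\<lambda>n. min 1 \<bar>a ^ r n * y (t - int (r n)) \<omega>\<bar> =
        \<bar>a ^ r n * y (t - int (r n)) \<omega>\<bar>) sequentially"
      by eventually_elim simp
    then have "(\<lambda>n. \<bar>a ^ r n * y (t - int (r n)) \<omega>\<bar>) \<longlonglongrightarrow> 0"
      using elim(1) by (simp add: tendsto_cong)
    then have "(\<lambda>n. y t \<omega> - a ^ r n * y (t - int (r n)) \<omega>) \<longlonglongrightarrow> y t \<omega> - 0"
      by (intro tendsto_intros) (simp add: tendsto_rabs_zero_iff)
    moreover have "(\<lambda>n. y t \<omega> - a ^ r n * y (t - int (r n)) \<omega>) =
        (\<lambda>n. \<Sum>k<r n. a ^ k * e (t - int k) \<omega>)"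
    proof
      fix n show "y t \<omega> - a ^ r n * y (t - int (r n)) \<omega> = (\<Sum>k<r n. a ^ k * e (t - int k) \<omega>)"
        using elim(2)[rule_format, of "r n"] by simp
    qed
    ultimately show ?case by simp
  qed
  then show ?thesis by blast
qed

text \<open>\<open>y\<close> is only almost surely a function of the past noise, so independence is stated for a
  causal version \<open>Y\<close> of it.\<close>

lemma causal_version:
  obtains Y where "\<And>t. Y t \<in> borel_measurable M" "\<And>t. AE \<omega> in M. y t \<omega> = Y t \<omega>"
    "\<And>m. indep_var (PiM {..m} (\<lambda>_. borel)) (\<lambda>\<omega>. \<lambda>t\<in>{..m}. Y t \<omega>)
      (PiM {m + 1} (\<lambda>_. borel)) (\<lambda>\<omega>. \<lambda>t\<in>{m + 1}. e t \<omega>)"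
proof -
  have "\<forall>t. \<exists>r. AE \<omega> in M. (\<lambda>n. \<Sum>k<r n. a ^ k * e (t - int k) \<omega>) \<longlonglongrightarrow> y t \<omega>"
    by (intro allI y_AE_limit)
  from choice[OF this] obtain r where
    r: "\<And>t. AE \<omega> in M. (\<lambda>n. \<Sum>k<r t n. a ^ k * e (t - int k) \<omega>) \<longlonglongrightarrow> y t \<omega>" by blast
  \<comment> \<open>\<open>g t\<close> reads only coordinates up to \<open>t\<close>, and
    \<open>lim\<close> is a measurable total function even where the sums diverge. Hence
    \<open>Y t\<close> is everywhere a measurable function of the noise up to
    \<open>t\<close>.\<close>
  define g where "g t x = lim (\<lambda>n. \<Sum>k<r t n. a ^ k * x (t - int k))" for t and x :: "int \<Rightarrow> real"
  define Y where "Y t \<omega> = g t (\<lambda>s. e s \<omega>)" for t \<omega>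
  have g [measurable]: "g t \<in> borel_measurable (PiM {..m} (\<lambda>_. borel))" if "t \<le> m" for t m
    unfolding g_def using that
    by (intro borel_measurable_lim_metric borel_measurable_sum borel_measurable_times
        measurable_component_singleton) auto
  have gr: "g t (restrict x {..m}) = g t x" if "t \<le> m" for t m x
    unfolding g_def using that by (intro arg_cong[where f = lim] ext sum.cong) auto
  show thesis
  proof
    fix t
    show "Y t \<in> borel_measurable M" unfolding Y_def g_def by measurable
    from r[of t] show "AE \<omega> in M. y t \<omega> = Y t \<omega>"
      by eventually_elim (simp add: Y_def g_def limI)
  next
    fix m
    have "indep_var (PiM {..m} (\<lambda>_. borel)) (\<lambda>\<omega>. restrict (\<lambda>i. e i \<omega>) {..m})
        (PiM {m + 1} (\<lambda>_. borel)) (\<lambda>\<omega>. restrict (\<lambda>i. e i \<omega>) {m + 1})"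
      by (rule indep_var_restrict[OF indep_e]) auto
    then have "indep_var (PiM {..m} (\<lambda>_. borel))
        ((\<lambda>x. \<lambda>t\<in>{..m}. g t x) \<circ> (\<lambda>\<omega>. restrict (\<lambda>i. e i \<omega>) {..m}))
        (PiM {m + 1} (\<lambda>_. borel)) ((\<lambda>x. x) \<circ> (\<lambda>\<omega>. restrict (\<lambda>i. e i \<omega>) {m + 1}))"
      by (rule indep_var_compose) (auto intro!: measurable_restrict)
    moreover have "(\<lambda>x. \<lambda>t\<in>{..m}. g t x) \<circ> (\<lambda>\<omega>. restrict (\<lambda>i. e i \<omega>) {..m}) =
        (\<lambda>\<omega>. \<lambda>t\<in>{..m}. Y t \<omega>)"
      by (auto simp: fun_eq_iff gr Y_def)
    ultimately show "indep_var (PiM {..m} (\<lambda>_. borel)) (\<lambda>\<omega>. \<lambda>t\<in>{..m}. Y t \<omega>)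
      (PiM {m + 1} (\<lambda>_. borel)) (\<lambda>\<omega>. \<lambda>t\<in>{m + 1}. e t \<omega>)"
      by (simp add: comp_def)
  qed
qed

section \<open>Integrating out the newest noise variable\<close>

text \<open>The path of \<open>y\<close> up to \<open>m\<close> agrees almost surely with that of a
  causal version, which is independent of \<open>e (m + 1)\<close>. The joint law is therefore a
  product, and the noise can be integrated first, against its density.\<close>

lemma nn_integral_past_noise:
  assumes K [measurable]: "K \<in> borel_measurable (PiM {..m} (\<lambda>_. borel) \<Otimes>\<^sub>M borel)"
  shows "(\<integral>\<^sup>+\<omega>. K (\<lambda>t\<in>{..m}. y t \<omega>, e (m + 1) \<omega>) \<partial>M) =
    (\<integral>\<^sup>+\<omega>. (\<integral>\<^sup>+x. K (\<lambda>t\<in>{..m}. y t \<omega>, x) * ennreal (normal_density 0 \<sigma> x) \<partial>lborel) \<partial>M)"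
proof -
  obtain Y where Y [measurable]: "\<And>t. Y t \<in> borel_measurable M"
    and yY: "\<And>t. AE \<omega> in M. y t \<omega> = Y t \<omega>"
    and "\<And>m. indep_var (PiM {..m} (\<lambda>_. borel)) (\<lambda>\<omega>. \<lambda>t\<in>{..m}. Y t \<omega>)
      (PiM {m + 1} (\<lambda>_. borel)) (\<lambda>\<omega>. \<lambda>t\<in>{m + 1}. e t \<omega>)"
    by (rule causal_version) blast
  note ind = this(3)[of m]
  let ?P = "PiM {..m} (\<lambda>_. borel :: real measure)" and ?X = "\<lambda>\<omega>. \<lambda>t\<in>{..m}. Y t \<omega>"
  let ?Q = "PiM {m + 1} (\<lambda>_. borel :: real measure)" and ?E = "\<lambda>\<omega>. \<lambda>t\<in>{m + 1}. e t \<omega>"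
  have X [measurable]: "?X \<in> M \<rightarrow>\<^sub>M ?P" by measurable
  have E [measurable]: "?E \<in> M \<rightarrow>\<^sub>M ?Q" by measurable
  interpret N: prob_space "distr M ?Q ?E"
    by (rule prob_space_distr) simp
  have AE: "AE \<omega> in M. (\<lambda>t\<in>{..m}. y t \<omega>) = ?X \<omega>"
  proof -
    have "AE \<omega> in M. \<forall>t. y t \<omega> = Y t \<omega>" by (simp add: AE_all_countable yY)
    then show ?thesis by eventually_elim auto
  qed
  \<comment> \<open>Independence is stated with the noise as a family over the single index
    \<open>m + 1\<close>; \<open>K'\<close> reads off that coordinate.\<close>
  define K' where "K' z = K (fst z, snd z (m + 1))" for z :: "(int \<Rightarrow> real) \<times> (int \<Rightarrow> real)"
  have K' [measurable]: "K' \<in> borel_measurable (?P \<Otimes>\<^sub>M ?Q)"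
    unfolding K'_def by measurable
  have inner: "(\<integral>\<^sup>+z. K' (x, z) \<partial>distr M ?Q ?E) =
      (\<integral>\<^sup>+z. K (x, z) * ennreal (normal_density 0 \<sigma> z) \<partial>lborel)" if x [measurable]: "x \<in> space ?P" for x
  proof -
    have "(\<integral>\<^sup>+z. K' (x, z) \<partial>distr M ?Q ?E) = (\<integral>\<^sup>+\<omega>. K (x, e (m + 1) \<omega>) \<partial>M)"
      by (subst nn_integral_distr) (auto simp: K'_def)
    also have "\<dots> = (\<integral>\<^sup>+z. K (x, z) \<partial>distr M borel (e (m + 1)))"
      by (subst nn_integral_distr) auto
    finally show ?thesis
      unfolding distr_e by (subst (asm) nn_integral_density) (auto simp: mult.commute)
  qed
  have "(\<integral>\<^sup>+\<omega>. K (\<lambda>t\<in>{..m}. y t \<omega>, e (m + 1) \<omega>) \<partial>M) = (\<integral>\<^sup>+\<omega>. K' (?X \<omega>, ?E \<omega>) \<partial>M)"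
    using AE by (intro nn_integral_cong_AE, eventually_elim) (simp add: K'_def)
  also have "\<dots> = (\<integral>\<^sup>+z. K' z \<partial>distr M (?P \<Otimes>\<^sub>M ?Q) (\<lambda>\<omega>. (?X \<omega>, ?E \<omega>)))"
    by (subst nn_integral_distr) measurable
  also have "\<dots> = (\<integral>\<^sup>+z. K' z \<partial>(distr M ?P ?X \<Otimes>\<^sub>M distr M ?Q ?E))"
    using ind by (simp add: indep_var_distribution_eq)
  also have "\<dots> = (\<integral>\<^sup>+x. \<integral>\<^sup>+z. K' (x, z) \<partial>distr M ?Q ?E \<partial>distr M ?P ?X)"
    by (rule N.nn_integral_fst[symmetric]) measurable
  also have "\<dots> = (\<integral>\<^sup>+x. \<integral>\<^sup>+z. K (x, z) * ennreal (normal_density 0 \<sigma> z) \<partial>lborel \<partial>distr M ?P ?X)"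
    by (intro nn_integral_cong inner) simp
  also have "\<dots> = (\<integral>\<^sup>+\<omega>. \<integral>\<^sup>+z. K (?X \<omega>, z) * ennreal (normal_density 0 \<sigma> z) \<partial>lborel \<partial>M)"
    by (subst nn_integral_distr) measurable
  also have "\<dots> = (\<integral>\<^sup>+\<omega>. (\<integral>\<^sup>+x. K (\<lambda>t\<in>{..m}. y t \<omega>, x) * ennreal (normal_density 0 \<sigma> x) \<partial>lborel) \<partial>M)"
    using AE by (intro nn_integral_cong_AE, eventually_elim) simp
  finally show ?thesis .
qed

text \<open>The induction step shared by both exponential moments: \<open>U\<close> collects what is
  determined by time \<open>m\<close>, and the new noise enters through a quadratic exponent whose
  linear coefficient depends on \<open>y m\<close>.\<close>

lemma nn_integral_integrate_out:
  assumes U [measurable]: "U \<in> borel_measurable (PiM {..m} (\<lambda>_. borel))"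
    and pos: "0 < 1 + 2 * c * \<sigma>\<^sup>2"
  shows "(\<integral>\<^sup>+\<omega>. U (\<lambda>t\<in>{..m}. y t \<omega>) *
      ennreal (exp (b * y m \<omega> * e (m + 1) \<omega> - c * (e (m + 1) \<omega>)\<^sup>2)) \<partial>M) =
    (\<integral>\<^sup>+\<omega>. U (\<lambda>t\<in>{..m}. y t \<omega>) *
      ennreal (exp ((b * y m \<omega>)\<^sup>2 * \<sigma>\<^sup>2 / (2 * (1 + 2 * c * \<sigma>\<^sup>2))) / sqrt (1 + 2 * c * \<sigma>\<^sup>2)) \<partial>M)"
proof -
  define K where "K = (\<lambda>z :: (int \<Rightarrow> real) \<times> real. U (fst z) *
      ennreal (exp (b * fst z m * snd z - c * (snd z)\<^sup>2)))"
  have "K \<in> borel_measurable (PiM {..m} (\<lambda>_. borel) \<Otimes>\<^sub>M borel)"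
    unfolding K_def by measurable
  note past = nn_integral_past_noise[OF this]
  have "(\<integral>\<^sup>+x. K (\<lambda>t\<in>{..m}. y t \<omega>, x) * ennreal (normal_density 0 \<sigma> x) \<partial>lborel) =
      U (\<lambda>t\<in>{..m}. y t \<omega>) *
      ennreal (exp ((b * y m \<omega>)\<^sup>2 * \<sigma>\<^sup>2 / (2 * (1 + 2 * c * \<sigma>\<^sup>2))) / sqrt (1 + 2 * c * \<sigma>\<^sup>2))" for \<omega>
    unfolding nn_integral_exp_quadratic_normal[OF \<sigma>_pos pos, of "b * y m \<omega>", symmetric]
    by (subst nn_integral_cmult[symmetric]) (auto simp: K_def mult.assoc)
  with past show ?thesis
    by (simp add: K_def)
qed

section \<open>The stationary Gaussian marginal\<close>

lemma a2_less: "a\<^sup>2 < 1"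
  using abs_a_less by (simp add: abs_square_less_1)

text \<open>The recursion gives \<open>\<phi> u = \<phi> (a * u) * exp (- (\<sigma> * u)\<^sup>2 /
  2)\<close> for the characteristic function. The claimed Gaussian solves the same equation, so the
  quotient \<open>h\<close> of the two is invariant under \<open>u\<close> to \<open>a * u\<close>,
  hence constant by continuity at 0.\<close>

lemma distr_y: "distr M borel (y t) = density lborel (normal_density 0 (\<sigma> / sqrt (1 - a\<^sup>2)))"
proof (rule Levy_uniqueness)
  define s where "s = \<sigma> / sqrt (1 - a\<^sup>2)"
  have s: "s > 0" using \<sigma>_pos a2_less by (simp add: s_def)
  \<comment> \<open>Variance balance of the recursion; it makes the noise factor cancel in
    \<open>h\<close>.\<close>
  have s2: "s\<^sup>2 = (a * s)\<^sup>2 + \<sigma>\<^sup>2" using a2_less by (simp add: s_def field_simps)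
  show "real_distribution (distr M borel (y t))"
    by (rule real_distribution_distr) simp
  then interpret R: real_distribution "distr M borel (y t)" .
  show "real_distribution (density lborel (normal_density 0 (\<sigma> / sqrt (1 - a\<^sup>2))))"
    using prob_space_normal_density[OF s]
    by (simp add: real_distribution_def real_distribution_axioms_def s_def)
  define \<phi> where "\<phi> = char (distr M borel (y t))"
  have step: "\<phi> u = \<phi> (a * u) * complex_of_real (exp (- (\<sigma> * u)\<^sup>2 / 2))" for u
  proof -
    obtain Y where Y [measurable]: "\<And>t. Y t \<in> borel_measurable M"
      and yY: "\<And>t. AE \<omega> in M. y t \<omega> = Y t \<omega>"
      and ind: "\<And>m. indep_var (PiM {..m} (\<lambda>_. borel)) (\<lambda>\<omega>. \<lambda>t\<in>{..m}. Y t \<omega>)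
        (PiM {m + 1} (\<lambda>_. borel)) (\<lambda>\<omega>. \<lambda>t\<in>{m + 1}. e t \<omega>)"
      by (rule causal_version) blast
    have "indep_var borel ((\<lambda>x. a * x (t - 1)) \<circ> (\<lambda>\<omega>. \<lambda>s\<in>{..t - 1}. Y s \<omega>))
        borel ((\<lambda>x. x t) \<circ> (\<lambda>\<omega>. \<lambda>s\<in>{t - 1 + 1}. e s \<omega>))"
      by (rule indep_var_compose[OF ind[of "t - 1"]]) measurable
    then have ind': "indep_var borel (\<lambda>\<omega>. a * Y (t - 1) \<omega>) borel (e t)"
      by (simp add: comp_def)
    have "distr M borel (y t) = distr M borel (\<lambda>\<omega>. a * Y (t - 1) \<omega> + e t \<omega>)"
    proof (rule distr_cong_AE)
      show "AE \<omega> in M. y t \<omega> = a * Y (t - 1) \<omega> + e t \<omega>"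
        using recursion[of t] yY[of "t - 1"] by eventually_elim simp
    qed auto
    then have "\<phi> u = char (distr M borel (\<lambda>\<omega>. a * Y (t - 1) \<omega>)) u * char (distr M borel (e t)) u"
      using char_distr_add[OF ind', of u] by (simp add: \<phi>_def)
    also have "char (distr M borel (\<lambda>\<omega>. a * Y (t - 1) \<omega>)) u = char (distr M borel (Y (t - 1))) (a * u)"
      unfolding char_def by (simp add: integral_distr mult_ac)
    also have "distr M borel (Y (t - 1)) = distr M borel (y (t - 1))"
    proof (rule distr_cong_AE)
      show "AE \<omega> in M. Y (t - 1) \<omega> = y (t - 1) \<omega>"
        using yY[of "t - 1"] by eventually_elim simp
    qed auto
    also have "distr M borel (y (t - 1)) = distr M borel (y t)" by (rule distr_y_eq)
    also have "char (distr M borel (e t)) u = complex_of_real (exp (- (\<sigma> * u)\<^sup>2 / 2))"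
      unfolding distr_e char_normal[OF \<sigma>_pos] ..
    finally show ?thesis by (simp add: \<phi>_def)
  qed
  show "char (distr M borel (y t)) = char (density lborel (normal_density 0 (\<sigma> / sqrt (1 - a\<^sup>2))))"
  proof
    fix u
    define h where "h u = \<phi> u * complex_of_real (exp ((s * u)\<^sup>2 / 2))" for u
    have h: "h u = h (a * u)" for u
    proof -
      have "exp ((s * u)\<^sup>2 / 2) = exp ((s * (a * u))\<^sup>2 / 2) * exp ((\<sigma> * u)\<^sup>2 / 2)"
        unfolding exp_add[symmetric] power_mult_distrib[of s u] s2
        by (simp add: power_mult_distrib algebra_simps add_divide_distrib)
      then show ?thesis
        unfolding h_def step[of u] by (simp add: exp_minus mult_ac)
    qed
    have hn: "h (a ^ n * u) = h u" for n
    proof (induction n)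
      case (Suc n)
      then show ?case using h[of "a ^ n * u"] by (simp add: mult.assoc)
    qed simp
    have "isCont h 0"
      unfolding h_def \<phi>_def by (intro continuous_intros R.isCont_char) auto
    then have "(\<lambda>n. h (a ^ n * u)) \<longlonglongrightarrow> h 0"
    proof (rule isCont_tendsto_compose)
      show "(\<lambda>n. a ^ n * u) \<longlonglongrightarrow> 0"
        using abs_a_less by (intro tendsto_mult_left_zero LIMSEQ_power_zero) simp
    qed
    then have "h u = h 0" unfolding hn by (simp add: LIMSEQ_const_iff)
    also have "h 0 = 1" by (simp add: h_def \<phi>_def R.char_zero)
    finally have "\<phi> u = complex_of_real (exp (- (s * u)\<^sup>2 / 2))"
      by (simp add: h_def exp_minus field_simps)
    then show "char (distr M borel (y t)) u = char (density lborel (normal_density 0 (\<sigma> / sqrt (1 - a\<^sup>2)))) u"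
      by (simp add: \<phi>_def char_normal[OF s] flip: s_def)
  qed
qed

section \<open>The two exponential moments\<close>

lemma atLeastAtMost_int_Suc: "{1..int (Suc m)} = insert (int m + 1) {1..int m}"
  by auto

text \<open>Given the past, the newest factor \<open>exp (\<theta> * y t * e (t + 1))\<close> has
  mean \<open>exp (\<theta>\<^sup>2 * \<sigma>\<^sup>2 / 2 * (y t)\<^sup>2)\<close>, which the
  subtracted square cancels. The noise is written as \<open>y (t + 1) - a * y t\<close> so that
  older terms depend on the path of \<open>y\<close> alone.\<close>

lemma nn_integral_exp_martingale:
  "(\<integral>\<^sup>+\<omega>. ennreal (exp (\<Sum>t = 1..int m.
      \<theta> * ((y (t + 1) \<omega> - a * y t \<omega>) * y t \<omega>) - \<theta>\<^sup>2 * \<sigma>\<^sup>2 / 2 * (y t \<omega>)\<^sup>2)) \<partial>M) = 1"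
proof (induction m)
  case 0
  then show ?case by (simp add: emeasure_space_1)
next
  case (Suc m)
  define L where "L x = (\<Sum>t = 1..int m.
      \<theta> * ((x (t + 1) - a * x t) * x t) - \<theta>\<^sup>2 * \<sigma>\<^sup>2 / 2 * (x t)\<^sup>2)" for x :: "int \<Rightarrow> real"
  \<comment> \<open>The subtracted square of the newest term is already determined at time
    \<open>m + 1\<close> and goes into \<open>U\<close>; only a term linear in the new noise stays
    outside, hence the coefficient 0 of its square below.\<close>
  define U where "U x = ennreal (exp (L x - \<theta>\<^sup>2 * \<sigma>\<^sup>2 / 2 * (x (int m + 1))\<^sup>2))" for x
  have [measurable]: "U \<in> borel_measurable (PiM {..int m + 1} (\<lambda>_. borel))"
    unfolding U_def L_def
    by (intro measurable_compose[OF _ measurable_ennreal] borel_measurable_exp borel_measurable_diff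
        borel_measurable_sum borel_measurable_times borel_measurable_power
        borel_measurable_const measurable_component_singleton) auto
  have L: "L (\<lambda>t\<in>{..int m + 1}. y t \<omega>) = L (\<lambda>t. y t \<omega>)" for \<omega>
    unfolding L_def by (intro sum.cong) auto
  have "(\<integral>\<^sup>+\<omega>. ennreal (exp (\<Sum>t = 1..int (Suc m).
      \<theta> * ((y (t + 1) \<omega> - a * y t \<omega>) * y t \<omega>) - \<theta>\<^sup>2 * \<sigma>\<^sup>2 / 2 * (y t \<omega>)\<^sup>2)) \<partial>M) =
    (\<integral>\<^sup>+\<omega>. U (\<lambda>t\<in>{..int m + 1}. y t \<omega>) *
      ennreal (exp (\<theta> * y (int m + 1) \<omega> * e (int m + 1 + 1) \<omega> - 0 * (e (int m + 1 + 1) \<omega>)\<^sup>2)) \<partial>M)"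
    using recursion[of "int m + 1 + 1"]
  proof (intro nn_integral_cong_AE, eventually_elim)
    case (elim \<omega>)
    have "(\<Sum>t = 1..int (Suc m). \<theta> * ((y (t + 1) \<omega> - a * y t \<omega>) * y t \<omega>) - \<theta>\<^sup>2 * \<sigma>\<^sup>2 / 2 * (y t \<omega>)\<^sup>2) =
        (L (\<lambda>t. y t \<omega>) - \<theta>\<^sup>2 * \<sigma>\<^sup>2 / 2 * (y (int m + 1) \<omega>)\<^sup>2) +
        (\<theta> * y (int m + 1) \<omega> * e (int m + 1 + 1) \<omega> - 0 * (e (int m + 1 + 1) \<omega>)\<^sup>2)"
      unfolding atLeastAtMost_int_Suc L_def using elim
      by (subst sum.insert) (auto simp: algebra_simps)
    then show ?case
      by (simp only: exp_add U_def L) (simp add: ennreal_mult')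
  qed
  also have "\<dots> = (\<integral>\<^sup>+\<omega>. U (\<lambda>t\<in>{..int m + 1}. y t \<omega>) *
      ennreal (exp ((\<theta> * y (int m + 1) \<omega>)\<^sup>2 * \<sigma>\<^sup>2 / (2 * (1 + 2 * 0 * \<sigma>\<^sup>2))) / sqrt (1 + 2 * 0 * \<sigma>\<^sup>2)) \<partial>M)"
    by (rule nn_integral_integrate_out) auto
  also have "\<dots> = (\<integral>\<^sup>+\<omega>. ennreal (exp (L (\<lambda>t. y t \<omega>))) \<partial>M)"
    by (intro nn_integral_cong)
      (simp add: U_def L power_mult_distrib mult_ac flip: ennreal_mult' exp_add)
  finally show ?case using Suc by (simp add: L_def)
qed

text \<open>Integrating out the last noise variable turns the weight \<open>p\<close> of the last square into
  \<open>1 + a\<^sup>2 + \<epsilon>\<^sup>2 - a\<^sup>2 / p\<close>, and \<open>\<rho>\<close> is the larger fixed point of this map.\<close>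

lemma nn_integral_exp_neg_squares:
  assumes \<rho>: "1 \<le> \<rho>" "\<rho> + a\<^sup>2 / \<rho> = 1 + a\<^sup>2 + \<epsilon>\<^sup>2" and p: "1 \<le> p" "p \<le> \<rho>"
  shows "(\<integral>\<^sup>+\<omega>. ennreal (exp (- (\<epsilon>\<^sup>2 / (2 * \<sigma>\<^sup>2)) * (\<Sum>t = 1..int m. (y t \<omega>)\<^sup>2)
      - (p - 1) / (2 * \<sigma>\<^sup>2) * (y (int m + 1) \<omega>)\<^sup>2)) \<partial>M)
    \<le> ennreal (sqrt ((1 - a\<^sup>2) / ((p - a\<^sup>2) * \<rho> ^ m)))"
  using p
proof (induction m arbitrary: p)
  case 0
  define s where "s = \<sigma> / sqrt (1 - a\<^sup>2)"
  define c where "c = (p - 1) / (2 * \<sigma>\<^sup>2)"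
  have s: "0 < s" using \<sigma>_pos a2_less by (simp add: s_def)
  \<comment> \<open>With \<open>m = 0\<close> only \<open>y 1\<close> is left, and its stationary
    law gives the bound with equality.\<close>
  have cs: "1 + 2 * c * s\<^sup>2 = (p - a\<^sup>2) / (1 - a\<^sup>2)"
    using \<sigma>_pos a2_less by (simp add: s_def c_def power_divide field_simps)
  have pos: "0 < 1 + 2 * c * s\<^sup>2" unfolding cs using a2_less 0 by simp
  have "(\<integral>\<^sup>+\<omega>. ennreal (exp (- c * (y 1 \<omega>)\<^sup>2)) \<partial>M) =
      (\<integral>\<^sup>+x. ennreal (exp (- c * x\<^sup>2)) \<partial>distr M borel (y 1))"
    by (subst nn_integral_distr) auto
  also have "\<dots> = (\<integral>\<^sup>+x. ennreal (exp (0 * x - c * x\<^sup>2)) * ennreal (normal_density 0 s x) \<partial>lborel)"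
    unfolding distr_y s_def[symmetric] by (subst nn_integral_density) (auto simp: mult.commute)
  also have "\<dots> = ennreal (sqrt ((1 - a\<^sup>2) / (p - a\<^sup>2)))"
    unfolding nn_integral_exp_quadratic_normal[OF s pos] cs by (simp add: real_sqrt_divide)
  finally show ?case by (simp add: c_def)
next
  case (Suc m)
  define c where "c = (p - 1) / (2 * \<sigma>\<^sup>2)"
  define \<mu> where "\<mu> = \<epsilon>\<^sup>2 / (2 * \<sigma>\<^sup>2)"
  define p' where "p' = 1 + a\<^sup>2 + \<epsilon>\<^sup>2 - a\<^sup>2 / p"
  define L where "L x = - \<mu> * (\<Sum>t = 1..int m. (x t)\<^sup>2)" for x :: "int \<Rightarrow> real"
  \<comment> \<open>Substituting \<open>y (m + 2) = a * y (m + 1) + e (m + 2)\<close> in the last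
    square adds \<open>c * a\<^sup>2\<close> to the weight \<open>\<mu>\<close> of the square of
    \<open>y (m + 1)\<close> and leaves a cross term with coefficient
    \<open>- 2 * a * c\<close>.\<close>
  define U where "U x = ennreal (exp (L x - (\<mu> + c * a\<^sup>2) * (x (int m + 1))\<^sup>2))" for x
  have p: "1 \<le> p" "p \<le> \<rho>" using Suc by auto
  have cp: "1 + 2 * c * \<sigma>\<^sup>2 = p" using \<sigma>_pos by (simp add: c_def field_simps)
  \<comment> \<open>The new weight stays between 1 and \<open>\<rho>\<close>, so the induction
    hypothesis applies to it.\<close>
  have p'1: "1 + \<epsilon>\<^sup>2 \<le> p'" using p by (simp add: p'_def divide_le_eq mult_le_cancel_left1)
  have "a\<^sup>2 / \<rho> \<le> a\<^sup>2 / p" using p by (intro divide_left_mono) auto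
  then have p'\<rho>: "p' \<le> \<rho>" using \<rho>(2) by (simp add: p'_def)
  have [measurable]: "U \<in> borel_measurable (PiM {..int m + 1} (\<lambda>_. borel))"
    unfolding U_def L_def
    by (intro measurable_compose[OF _ measurable_ennreal] borel_measurable_exp borel_measurable_diff
        borel_measurable_sum borel_measurable_times borel_measurable_power
        borel_measurable_const measurable_component_singleton) auto
  have L: "L (\<lambda>t\<in>{..int m + 1}. y t \<omega>) = L (\<lambda>t. y t \<omega>)" for \<omega>
    unfolding L_def by (intro arg_cong2[where f = "(*)"] sum.cong) auto
  have "(\<integral>\<^sup>+\<omega>. ennreal (exp (- \<mu> * (\<Sum>t = 1..int (Suc m). (y t \<omega>)\<^sup>2)
      - c * (y (int (Suc m) + 1) \<omega>)\<^sup>2)) \<partial>M) =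
    (\<integral>\<^sup>+\<omega>. U (\<lambda>t\<in>{..int m + 1}. y t \<omega>) *
      ennreal (exp ((- 2 * a * c) * y (int m + 1) \<omega> * e (int m + 1 + 1) \<omega> - c * (e (int m + 1 + 1) \<omega>)\<^sup>2)) \<partial>M)"
    using recursion[of "int m + 1 + 1"]
  proof (intro nn_integral_cong_AE, eventually_elim)
    case (elim \<omega>)
    have y: "y (int (Suc m) + 1) \<omega> = a * y (int m + 1) \<omega> + e (int m + 1 + 1) \<omega>"
      using elim by (simp add: add.commute)
    have "- \<mu> * (\<Sum>t = 1..int (Suc m). (y t \<omega>)\<^sup>2) - c * (y (int (Suc m) + 1) \<omega>)\<^sup>2 =
        (L (\<lambda>t. y t \<omega>) - (\<mu> + c * a\<^sup>2) * (y (int m + 1) \<omega>)\<^sup>2) +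
        ((- 2 * a * c) * y (int m + 1) \<omega> * e (int m + 1 + 1) \<omega> - c * (e (int m + 1 + 1) \<omega>)\<^sup>2)"
      unfolding atLeastAtMost_int_Suc L_def y
      by (subst sum.insert) (auto simp: algebra_simps power2_eq_square)
    then show ?case
      by (simp only: exp_add U_def L) (simp add: ennreal_mult')
  qed
  also have "\<dots> = (\<integral>\<^sup>+\<omega>. U (\<lambda>t\<in>{..int m + 1}. y t \<omega>) *
      ennreal (exp (((- 2 * a * c) * y (int m + 1) \<omega>)\<^sup>2 * \<sigma>\<^sup>2 / (2 * (1 + 2 * c * \<sigma>\<^sup>2))) / sqrt (1 + 2 * c * \<sigma>\<^sup>2)) \<partial>M)"
    by (rule nn_integral_integrate_out) (use p in \<open>auto simp: cp\<close>)
  also have "\<dots> = (\<integral>\<^sup>+\<omega>. ennreal (1 / sqrt p) * ennreal (exp (L (\<lambda>t. y t \<omega>)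
      - (p' - 1) / (2 * \<sigma>\<^sup>2) * (y (int m + 1) \<omega>)\<^sup>2)) \<partial>M)"
  proof (intro nn_integral_cong)
    fix \<omega>
    let ?v = "y (int m + 1) \<omega>"
    have "(2 * a * c)\<^sup>2 * \<sigma>\<^sup>2 / (2 * p) = (\<mu> + c * a\<^sup>2) - (p' - 1) / (2 * \<sigma>\<^sup>2)"
      using p \<sigma>_pos by (simp add: \<mu>_def c_def p'_def field_simps power2_eq_square)
    moreover have "((- 2 * a * c) * ?v)\<^sup>2 * \<sigma>\<^sup>2 / (2 * p) = (2 * a * c)\<^sup>2 * \<sigma>\<^sup>2 / (2 * p) * ?v\<^sup>2"
      by (simp add: power_mult_distrib)
    ultimately have "L (\<lambda>t. y t \<omega>) - (\<mu> + c * a\<^sup>2) * ?v\<^sup>2 + ((- 2 * a * c) * ?v)\<^sup>2 * \<sigma>\<^sup>2 / (2 * p) =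
        L (\<lambda>t. y t \<omega>) - (p' - 1) / (2 * \<sigma>\<^sup>2) * ?v\<^sup>2"
      by (simp only: left_diff_distrib)
    then show "U (\<lambda>t\<in>{..int m + 1}. y t \<omega>) *
      ennreal (exp (((- 2 * a * c) * ?v)\<^sup>2 * \<sigma>\<^sup>2 / (2 * (1 + 2 * c * \<sigma>\<^sup>2))) / sqrt (1 + 2 * c * \<sigma>\<^sup>2)) =
      ennreal (1 / sqrt p) * ennreal (exp (L (\<lambda>t. y t \<omega>) - (p' - 1) / (2 * \<sigma>\<^sup>2) * ?v\<^sup>2))"
      unfolding cp U_def L using p
      by (simp add: mult_exp_exp flip: ennreal_mult')
  qed
  also have "\<dots> = ennreal (1 / sqrt p) * (\<integral>\<^sup>+\<omega>. ennreal (exp (L (\<lambda>t. y t \<omega>)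
      - (p' - 1) / (2 * \<sigma>\<^sup>2) * (y (int m + 1) \<omega>)\<^sup>2)) \<partial>M)"
    unfolding L_def by (rule nn_integral_cmult) measurable
  also have "\<dots> \<le> ennreal (1 / sqrt p) * ennreal (sqrt ((1 - a\<^sup>2) / ((p' - a\<^sup>2) * \<rho> ^ m)))"
    unfolding L_def \<mu>_def using p'1 p'\<rho> zero_le_power2[of \<epsilon>]
    by (intro mult_left_mono Suc.IH zero_le) linarith+
  also have "\<dots> = ennreal (sqrt ((1 - a\<^sup>2) / (p * (p' - a\<^sup>2) * \<rho> ^ m)))"
    using p by (subst ennreal_mult'[symmetric]) (simp_all add: real_sqrt_divide real_sqrt_mult mult.assoc)
  also have "\<dots> \<le> ennreal (sqrt ((1 - a\<^sup>2) / ((p - a\<^sup>2) * \<rho> ^ Suc m)))"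
  proof -
    \<comment> \<open>One step must gain a factor of at least \<open>\<rho>\<close>, that is,
      \<open>\<rho> * (p - a\<^sup>2) \<le> p * (p' - a\<^sup>2)\<close>. In terms of
      \<open>s\<close>, the other root of the quadratic defining \<open>\<rho>\<close>, the
      difference factors.\<close>
    define s where "s = a\<^sup>2 / \<rho>"
    have a2s: "a\<^sup>2 = s * \<rho>" using \<rho> by (simp add: s_def)
    have "p * (p' - a\<^sup>2) - \<rho> * (p - a\<^sup>2) = s * (\<rho> - 1) * (\<rho> - p)"
    proof -
      have "p * p' = p * (\<rho> + s) - s * \<rho>"
        using p \<rho>(2) by (simp add: p'_def s_def field_simps)
      then show ?thesis by (simp add: a2s algebra_simps)
    qed
    also have "\<dots> \<ge> 0" using \<rho> p by (simp add: s_def)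
    finally have "\<rho> * (p - a\<^sup>2) \<le> p * (p' - a\<^sup>2)" by simp
    then have "\<rho> * (p - a\<^sup>2) * \<rho> ^ m \<le> p * (p' - a\<^sup>2) * \<rho> ^ m"
      using \<rho> by (intro mult_right_mono) auto
    moreover have "0 < \<rho> * (p - a\<^sup>2) * \<rho> ^ m" using \<rho> p a2_less by simp
    ultimately have "(1 - a\<^sup>2) / (p * (p' - a\<^sup>2) * \<rho> ^ m) \<le> (1 - a\<^sup>2) / (\<rho> * (p - a\<^sup>2) * \<rho> ^ m)"
      using a2_less by (intro frac_le) auto
    then show ?thesis
      by (intro ennreal_leI real_sqrt_le_mono) (simp add: mult_ac)
  qed
  finally show ?case by (simp add: \<mu>_def c_def)
qed

section \<open>The estimation error and its tails\<close>

text \<open>\<open>y 1\<close> has a density, so it is almost surely nonzero and the denominator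
  positive; the rest is an index shift.\<close>

lemma ls_estimate_error:
  assumes N: "2 \<le> N"
  shows "AE \<omega> in M. 0 < (\<Sum>t = 1..int N - 1. (y t \<omega>)\<^sup>2) \<and>
    ls_estimate y N \<omega> - a =
      (\<Sum>t = 1..int N - 1. (y (t + 1) \<omega> - a * y t \<omega>) * y t \<omega>) / (\<Sum>t = 1..int N - 1. (y t \<omega>)\<^sup>2)"
proof -
  have "AE x in distr M borel (y 1). x \<noteq> 0"
    unfolding distr_y using AE_lborel_singleton[of "0 :: real"]
    by (subst AE_density) (auto elim: eventually_mono)
  then have "AE \<omega> in M. y 1 \<omega> \<noteq> 0"
    by (subst (asm) AE_distr_iff) auto
  then show ?thesis
  proof eventually_elim
    case (elim \<omega>)
    let ?D = "\<Sum>t = 1..int N - 1. (y t \<omega>)\<^sup>2"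
    have "0 < (y 1 \<omega>)\<^sup>2" using elim by simp
    also have "\<dots> \<le> ?D" using N by (intro member_le_sum) auto
    finally have D: "0 < ?D" .
    have "(\<Sum>t = 2..int N. y t \<omega> * y (t - 1) \<omega>) = (\<Sum>t = 1..int N - 1. y (t + 1) \<omega> * y t \<omega>)"
      by (rule sum.reindex_bij_witness[of _ "\<lambda>t. t + 1" "\<lambda>t. t - 1"]) auto
    also have "\<dots> = (\<Sum>t = 1..int N - 1. (y (t + 1) \<omega> - a * y t \<omega>) * y t \<omega>) + a * ?D"
      by (simp add: sum_distrib_left sum.distrib[symmetric] algebra_simps power2_eq_square)
    finally show ?case using D by (simp add: ls_estimate_def field_simps)
  qed
qed

lemma measurable_ls_estimate [measurable]: "ls_estimate y N \<in> borel_measurable M"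
  unfolding ls_estimate_def[abs_def] by measurable

text \<open>AM-GM, with weights depending on the bound \<open>\<kappa>\<close> itself, replaces Cauchy-Schwarz here.\<close>

lemma prob_ls_error_ge:
  assumes N: "2 \<le> N" and \<epsilon>: "0 < \<epsilon>" and s: "\<bar>s\<bar> = 1"
    and \<rho>: "1 \<le> \<rho>" "\<rho> + a\<^sup>2 / \<rho> = 1 + a\<^sup>2 + \<epsilon>\<^sup>2"
  shows "prob {\<omega> \<in> space M. \<epsilon> \<le> s * (ls_estimate y N \<omega> - a)} \<le>
    ((1 - a\<^sup>2) / (1 - a\<^sup>2 + \<epsilon>\<^sup>2)) powr (1 / 4) * \<rho> powr (- ((real N - 2) / 4))"
proof -
  obtain m where Nm: "N = m + 2" using N by (metis add.commute le_iff_add)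
  define \<kappa> where "\<kappa> = ((1 - a\<^sup>2) / (1 - a\<^sup>2 + \<epsilon>\<^sup>2)) powr (1 / 4) * \<rho> powr (- ((real N - 2) / 4))"
  \<comment> \<open>The sign \<open>s\<close> selects the tail. For \<open>s = 1\<close> this value
    minimises \<open>\<theta>\<^sup>2 * \<sigma>\<^sup>2 / 2 - \<theta> * \<epsilon>\<close>, the
    coefficient of the sum of squares left once the martingale is split off; the minimum is the
    coefficient in \<open>B\<close>.\<close>
  define \<theta> where "\<theta> = s * \<epsilon> / \<sigma>\<^sup>2"
  define A where "A \<omega> = exp (\<Sum>t = 1..int (m + 1).
      \<theta> * ((y (t + 1) \<omega> - a * y t \<omega>) * y t \<omega>) - \<theta>\<^sup>2 * \<sigma>\<^sup>2 / 2 * (y t \<omega>)\<^sup>2)" for \<omega>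
  define B where "B \<omega> = exp (- (\<epsilon>\<^sup>2 / (2 * \<sigma>\<^sup>2)) * (\<Sum>t = 1..int (m + 1). (y t \<omega>)\<^sup>2))" for \<omega>
  have [measurable]: "A \<in> borel_measurable M" "B \<in> borel_measurable M"
    unfolding A_def B_def by measurable
  have pos: "0 < (1 - a\<^sup>2) / (1 - a\<^sup>2 + \<epsilon>\<^sup>2)" using a2_less by (simp add: add_pos_nonneg)
  have \<kappa>: "0 < \<kappa>" unfolding \<kappa>_def using pos \<rho>(1) by (intro mult_pos_pos) auto
  have s2: "s\<^sup>2 = 1" using s by (metis one_power2 power2_abs)
  have IA: "(\<integral>\<^sup>+\<omega>. ennreal (A \<omega>) \<partial>M) = 1"
    unfolding A_def by (rule nn_integral_exp_martingale)
  have IB: "(\<integral>\<^sup>+\<omega>. ennreal (B \<omega>) \<partial>M) \<le> ennreal (\<kappa>\<^sup>2)"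
  proof -
    \<comment> \<open>Of the \<open>m + 1\<close> squares the last is taken as the terminal term of
      weight \<open>p = 1 + \<epsilon>\<^sup>2\<close>, so the power of \<open>\<rho>\<close> is
      \<open>m = N - 2\<close>.\<close>
    have "a\<^sup>2 / \<rho> \<le> a\<^sup>2" using \<rho> by (simp add: divide_le_eq mult_le_cancel_left1)
    then have p: "1 + \<epsilon>\<^sup>2 \<le> \<rho>" using \<rho>(2) by simp
    have "(\<integral>\<^sup>+\<omega>. ennreal (B \<omega>) \<partial>M) = (\<integral>\<^sup>+\<omega>. ennreal (exp (- (\<epsilon>\<^sup>2 / (2 * \<sigma>\<^sup>2)) * (\<Sum>t = 1..int m. (y t \<omega>)\<^sup>2)
      - (1 + \<epsilon>\<^sup>2 - 1) / (2 * \<sigma>\<^sup>2) * (y (int m + 1) \<omega>)\<^sup>2)) \<partial>M)"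
    proof (intro nn_integral_cong)
      fix \<omega>
      have "(\<Sum>t = 1..int (Suc m). (y t \<omega>)\<^sup>2) = (y (int m + 1) \<omega>)\<^sup>2 + (\<Sum>t = 1..int m. (y t \<omega>)\<^sup>2)"
        unfolding atLeastAtMost_int_Suc by (subst sum.insert) auto
      then show "ennreal (B \<omega>) = ennreal (exp (- (\<epsilon>\<^sup>2 / (2 * \<sigma>\<^sup>2)) * (\<Sum>t = 1..int m. (y t \<omega>)\<^sup>2)
          - (1 + \<epsilon>\<^sup>2 - 1) / (2 * \<sigma>\<^sup>2) * (y (int m + 1) \<omega>)\<^sup>2))"
        unfolding B_def Suc_eq_plus1[symmetric] by (simp only:) (simp add: algebra_simps)
    qed
    also have "\<dots> \<le> ennreal (sqrt ((1 - a\<^sup>2) / ((1 + \<epsilon>\<^sup>2 - a\<^sup>2) * \<rho> ^ m)))"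
      by (rule nn_integral_exp_neg_squares[OF \<rho>]) (use p in auto)
    also have "sqrt ((1 - a\<^sup>2) / ((1 + \<epsilon>\<^sup>2 - a\<^sup>2) * \<rho> ^ m)) = \<kappa>\<^sup>2"
    proof -
      have sq: "(x powr (1 / 4))\<^sup>2 = x powr (1 / 2)" if "0 < x" for x :: real
        using that by (simp add: powr_power)
      have "sqrt ((1 - a\<^sup>2) / ((1 + \<epsilon>\<^sup>2 - a\<^sup>2) * \<rho> ^ m)) =
          sqrt ((1 - a\<^sup>2) / (1 - a\<^sup>2 + \<epsilon>\<^sup>2)) * sqrt (1 / \<rho> ^ m)"
        by (simp add: real_sqrt_mult real_sqrt_divide add_diff_eq add.commute)
      also have "\<dots> = ((1 - a\<^sup>2) / (1 - a\<^sup>2 + \<epsilon>\<^sup>2)) powr (1 / 2) * (\<rho> powr (- real m)) powr (1 / 2)"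
        using pos \<rho> by (simp add: powr_half_sqrt powr_minus_divide powr_realpow)
      also have "\<dots> = \<kappa>\<^sup>2"
        unfolding \<kappa>_def power_mult_distrib Nm sq[OF pos] using \<rho>
        by (simp add: powr_power powr_powr)
      finally show ?thesis .
    qed
    finally show ?thesis .
  qed
  have "emeasure M {\<omega> \<in> space M. \<epsilon> \<le> s * (ls_estimate y N \<omega> - a)} =
      (\<integral>\<^sup>+\<omega>. indicator {\<omega> \<in> space M. \<epsilon> \<le> s * (ls_estimate y N \<omega> - a)} \<omega> \<partial>M)"
    by (subst nn_integral_indicator) auto
  \<comment> \<open>On the event \<open>1 \<le> A \<omega> * B \<omega>\<close>, so AM-GM for
    \<open>\<kappa> * A \<omega>\<close> and \<open>B \<omega> / \<kappa>\<close> dominates the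
    indicator; after integration each term contributes at most \<open>\<kappa> / 2\<close>.\<close>
  also have "\<dots> \<le> (\<integral>\<^sup>+\<omega>. ennreal (\<kappa> / 2) * ennreal (A \<omega>) + ennreal (1 / (2 * \<kappa>)) * ennreal (B \<omega>) \<partial>M)"
    using ls_estimate_error[OF N]
  proof (intro nn_integral_mono_AE, eventually_elim)
    case (elim \<omega>)
    show ?case
    proof (cases "\<epsilon> \<le> s * (ls_estimate y N \<omega> - a)")
      case True
      define W where "W = (\<Sum>t = 1..int (m + 1). (y (t + 1) \<omega> - a * y t \<omega>) * y t \<omega>)"
      define D where "D = (\<Sum>t = 1..int (m + 1). (y t \<omega>)\<^sup>2)"
      have mN: "int N - 1 = int (m + 1)" using Nm by simp
      have D: "0 < D" and "ls_estimate y N \<omega> - a = W / D"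
        using elim unfolding mN W_def D_def by auto
      then have "\<epsilon> \<le> s * W / D" using True by simp
      then have "\<epsilon> * D \<le> s * W" using D by (simp add: le_divide_eq)
      then have "0 \<le> \<epsilon> / \<sigma>\<^sup>2 * (s * W - \<epsilon> * D)" using \<epsilon> by simp
      also have "\<dots> = (\<theta> * W - \<theta>\<^sup>2 * \<sigma>\<^sup>2 / 2 * D) + - (\<epsilon>\<^sup>2 / (2 * \<sigma>\<^sup>2)) * D"
        using \<sigma>_pos s2 by (simp add: \<theta>_def field_simps power2_eq_square)
      finally have "1 \<le> exp ((\<theta> * W - \<theta>\<^sup>2 * \<sigma>\<^sup>2 / 2 * D) + - (\<epsilon>\<^sup>2 / (2 * \<sigma>\<^sup>2)) * D)" by simp
      also have "\<dots> = A \<omega> * B \<omega>"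
        by (simp add: A_def B_def W_def D_def exp_add sum_subtractf sum_distrib_left)
      finally have AB: "1 \<le> A \<omega> * B \<omega>" .
      have "0 < A \<omega>" "0 < B \<omega>" by (auto simp: A_def B_def)
      have "1 \<le> sqrt (A \<omega> * B \<omega>)" using AB by simp
      also have "A \<omega> * B \<omega> = (\<kappa> * A \<omega>) * (B \<omega> / \<kappa>)" using \<kappa> by simp
      also have "sqrt \<dots> \<le> (\<kappa> * A \<omega> + B \<omega> / \<kappa>) / 2"
        using \<kappa> \<open>0 < A \<omega>\<close> \<open>0 < B \<omega>\<close> by (intro arith_geo_mean_sqrt) auto
      finally have "1 \<le> \<kappa> / 2 * A \<omega> + 1 / (2 * \<kappa>) * B \<omega>" by (simp add: field_simps)
      then have "1 \<le> ennreal (\<kappa> / 2 * A \<omega> + 1 / (2 * \<kappa>) * B \<omega>)"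
        by (metis ennreal_1 ennreal_leI)
      also have "\<dots> = ennreal (\<kappa> / 2) * ennreal (A \<omega>) + ennreal (1 / (2 * \<kappa>)) * ennreal (B \<omega>)"
        using \<kappa> \<open>0 < A \<omega>\<close> \<open>0 < B \<omega>\<close>
        by (subst ennreal_plus) (simp_all add: ennreal_mult'[symmetric])
      finally show ?thesis by (auto simp: indicator_def)
    qed simp
  qed
  also have "\<dots> = ennreal (\<kappa> / 2) * (\<integral>\<^sup>+\<omega>. ennreal (A \<omega>) \<partial>M) +
      ennreal (1 / (2 * \<kappa>)) * (\<integral>\<^sup>+\<omega>. ennreal (B \<omega>) \<partial>M)"
    by (simp add: nn_integral_add nn_integral_cmult)
  also have "\<dots> \<le> ennreal (\<kappa> / 2) * 1 + ennreal (1 / (2 * \<kappa>)) * ennreal (\<kappa>\<^sup>2)"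
    unfolding IA by (intro add_left_mono mult_left_mono IB) simp
  also have "\<dots> = ennreal \<kappa>"
    using \<kappa> by (simp add: power2_eq_square flip: ennreal_mult' ennreal_plus)
  finally show ?thesis
    using \<kappa> by (simp add: emeasure_eq_measure flip: \<kappa>_def)
qed

lemma prob_ls_error_gt:
  assumes N: "2 \<le> N" and \<epsilon>: "0 < \<epsilon>"
  shows "\<P>(\<omega> in M. ls_estimate y N \<omega> - a > \<epsilon>) \<le>
    ((1 - a\<^sup>2) / (1 - a\<^sup>2 + \<epsilon>\<^sup>2)) powr (1 / 4) *
    ((1 + a\<^sup>2 + \<epsilon>\<^sup>2) / 2 + sqrt (((1 + a\<^sup>2 + \<epsilon>\<^sup>2) / 2)\<^sup>2 - a\<^sup>2)) powr (- ((real N - 2) / 4))"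
proof -
  have "\<P>(\<omega> in M. ls_estimate y N \<omega> - a > \<epsilon>) \<le>
      prob {\<omega> \<in> space M. \<epsilon> \<le> 1 * (ls_estimate y N \<omega> - a)}"
    by (intro finite_measure_mono) auto
  also have "\<dots> \<le> ((1 - a\<^sup>2) / (1 - a\<^sup>2 + \<epsilon>\<^sup>2)) powr (1 / 4) *
    ((1 + a\<^sup>2 + \<epsilon>\<^sup>2) / 2 + sqrt (((1 + a\<^sup>2 + \<epsilon>\<^sup>2) / 2)\<^sup>2 - a\<^sup>2)) powr (- ((real N - 2) / 4))"
    using plus_divide_root[of "a\<^sup>2" "\<epsilon>\<^sup>2"] a2_less N \<epsilon> by (intro prob_ls_error_ge) auto
  finally show ?thesis .
qed

section \<open>The mean squared error\<close>

text \<open>The prefactor of the tail bound is at most 1 and is dropped; two tails give the factor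
  2. The decay exponent \<open>(N - 2) / 4\<close> exceeds 1 exactly when
  \<open>N > 6\<close>.\<close>

lemma second_moment_ls_error:
  assumes N: "7 \<le> N"
  shows "integrable M (\<lambda>\<omega>. (ls_estimate y N \<omega> - a)\<^sup>2)"
    and "(\<integral>\<omega>. (ls_estimate y N \<omega> - a)\<^sup>2 \<partial>M) \<le> 8 / (real N - 6) - 8 * a\<^sup>2 / (real N + 2)"
proof -
  let ?Z = "\<lambda>\<omega>. ls_estimate y N \<omega> - a" and ?k = "(real N - 2) / 4"
  have N6: "0 < real N - 6" using N by simp
  have "(\<integral>\<^sup>+\<omega>. ennreal ((?Z \<omega>)\<^sup>2) \<partial>M) \<le> ennreal (2 / (?k - 1) - 2 * a\<^sup>2 / (?k + 1))"
  proof (rule nn_integral_le_of_tail_bound)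
    fix r :: real assume r: "1 < r"
    \<comment> \<open>The deviation for which the larger root \<open>\<rho>\<close> is the given
      \<open>r\<close>.\<close>
    define \<epsilon> where "\<epsilon> = sqrt (r + a\<^sup>2 / r - 1 - a\<^sup>2)"
    have "r + a\<^sup>2 / r - 1 - a\<^sup>2 = (r - 1) * (r - a\<^sup>2) / r"
      using r by (simp add: field_simps)
    also have "\<dots> > 0" using r a2_less by simp
    finally have \<epsilon>2: "\<epsilon>\<^sup>2 = r + a\<^sup>2 / r - 1 - a\<^sup>2" and \<epsilon>: "0 < \<epsilon>"
      by (auto simp: \<epsilon>_def)
    have bound: "prob {\<omega> \<in> space M. \<epsilon> \<le> s * ?Z \<omega>} \<le> r powr - ?k" if "\<bar>s\<bar> = 1" for s
    proof -
      have "prob {\<omega> \<in> space M. \<epsilon> \<le> s * ?Z \<omega>} \<le>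
          ((1 - a\<^sup>2) / (1 - a\<^sup>2 + \<epsilon>\<^sup>2)) powr (1 / 4) * r powr - ?k"
        using N \<epsilon> that r \<epsilon>2 by (intro prob_ls_error_ge) auto
      also have "\<dots> \<le> 1 * r powr - ?k"
        using a2_less by (intro mult_right_mono powr_le1) (auto simp: add_pos_nonneg)
      finally show ?thesis by simp
    qed
    have "prob {\<omega> \<in> space M. r + a\<^sup>2 / r - 1 - a\<^sup>2 \<le> (?Z \<omega>)\<^sup>2} \<le>
        prob ({\<omega> \<in> space M. \<epsilon> \<le> 1 * ?Z \<omega>} \<union> {\<omega> \<in> space M. \<epsilon> \<le> (- 1) * ?Z \<omega>})"
    proof (intro finite_measure_mono)
      show "{\<omega> \<in> space M. r + a\<^sup>2 / r - 1 - a\<^sup>2 \<le> (?Z \<omega>)\<^sup>2} \<subseteq>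
          {\<omega> \<in> space M. \<epsilon> \<le> 1 * ?Z \<omega>} \<union> {\<omega> \<in> space M. \<epsilon> \<le> (- 1) * ?Z \<omega>}"
        unfolding \<epsilon>2[symmetric] abs_le_square_iff[symmetric] using \<epsilon> by auto
    qed auto
    also have "\<dots> \<le> prob {\<omega> \<in> space M. \<epsilon> \<le> 1 * ?Z \<omega>} + prob {\<omega> \<in> space M. \<epsilon> \<le> (- 1) * ?Z \<omega>}"
      by (intro measure_Un_le) auto
    also have "\<dots> \<le> 2 * r powr - ?k" using bound[of 1] bound[of "- 1"] by simp
    finally show "prob {\<omega> \<in> space M. r + a\<^sup>2 / r - 1 - a\<^sup>2 \<le> (?Z \<omega>)\<^sup>2} \<le> 2 * r powr - ?k" .
  qed (use a2_less N6 in auto)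
  also have "2 / (?k - 1) - 2 * a\<^sup>2 / (?k + 1) = 8 / (real N - 6) - 8 * a\<^sup>2 / (real N + 2)"
    using N6 by (simp add: field_simps)
  finally have le: "(\<integral>\<^sup>+\<omega>. ennreal ((?Z \<omega>)\<^sup>2) \<partial>M) \<le> ennreal (8 / (real N - 6) - 8 * a\<^sup>2 / (real N + 2))" .
  show int: "integrable M (\<lambda>\<omega>. (?Z \<omega>)\<^sup>2)"
    using le by (intro integrableI_nonneg) (auto simp: top_unique less_top[symmetric])
  \<comment> \<open>The bound is nonnegative, so the inequality in \<open>ennreal\<close> carries
    over to the reals.\<close>
  have "8 * a\<^sup>2 / (real N + 2) \<le> 8 / (real N - 6)"
    using a2_less N6 by (intro frac_le) auto
  then show "(\<integral>\<omega>. (?Z \<omega>)\<^sup>2 \<partial>M) \<le> 8 / (real N - 6) - 8 * a\<^sup>2 / (real N + 2)"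
    using le int by (simp add: nn_integral_eq_integral)
qed

end

theorem theorem1:
  fixes M :: "'a measure" and a0 \<sigma> :: real and e y :: "int \<Rightarrow> 'a \<Rightarrow> real"
  assumes "prob_space M"
    and "\<bar>a0\<bar> < 1"
    and "\<sigma> > 0"
    and "gaussian_white_noise M \<sigma> e"
    and "stationary_AR1 M a0 e y"
  shows "(\<forall>\<epsilon>::real. \<forall>N::nat. \<epsilon> > 0 \<longrightarrow> N \<ge> 2 \<longrightarrow>
            \<P>(\<omega> in M. ls_estimate y N \<omega> - a0 > \<epsilon>) \<le>
              ((1 - a0\<^sup>2) / (1 - a0\<^sup>2 + \<epsilon>\<^sup>2)) powr (1 / 4) *
              ((1 + a0\<^sup>2 + \<epsilon>\<^sup>2) / 2 + sqrt (((1 + a0\<^sup>2 + \<epsilon>\<^sup>2) / 2)\<^sup>2 - a0\<^sup>2))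
                powr (- ((real N - 2) / 4))) \<and>
         (\<forall>N::nat. N \<ge> 7 \<longrightarrow>
            integrable M (\<lambda>\<omega>. (ls_estimate y N \<omega> - a0)\<^sup>2) \<and>
            (\<integral>\<omega>. (ls_estimate y N \<omega> - a0)\<^sup>2 \<partial>M) \<le> 8 / (real N - 6) - 8 * a0\<^sup>2 / (real N + 2))"
proof -
  interpret gaussian_ar1 M a0 \<sigma> e y
    using assms by (simp add: gaussian_ar1_def gaussian_ar1_axioms_def)
  show ?thesis
    using prob_ls_error_gt second_moment_ls_error by blast
qed

end
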